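(* Let $L\geqslant 2$ and let $\varphi$ be the generalised Thue--Morse substitution over the $L$ letters $\{0,1,\dots,L-1\}$, i.e. $\varphi(a)=\varphi_0(a)\varphi_1(a)\cdots\varphi_{L-1}(a)$ with $\varphi_i(a)=a+i \pmod L$. Let $g$ be the permutation $a\mapsto a+1\pmod L$. Then $\varphi$ is $g^{L-1}$-palindromic. Consequently, for any fixed point $w$ of $\varphi$ one has $$A_w(L^n-1)\geqslant L^n\qquad\text{for all } n\geqslant 1.$$
   Context: $\mathbb{N}=\mathbb{Z}_{\geqslant0}$. A substitution is extended to words by concatenation; a fixed point of $\varphi$ is an infinite word $w\in\{0,\dots,L-1\}^{\mathbb{N}}$ with $\varphi(w)=w$. A substitution $\varrho$ of constant length $L$ with bijective columns $\varrho_0,\dots,\varrho_{L-1}$ ($\varrho_i(a)$ is the $i$-th letter of $\varrho(a)$, indices from $0$) is called $h$-palindromic, for $h$ in the group generated by its columns, if $\varrho_i\cdot\varrho_{L-1-i}=h$ (composition of permutations) for all $0\leqslant i\leqslant L-1$. For an infinite word $w$ and $d\geqslant1$, $A_w(d)$ is the maximum (supremum, in $\mathbb{N}\cup\{\infty\}$) of all $M$ such that there is $k\in\mathbb{N}$ with $w_k=w_{k+dn}$ for all $0\leqslant n\leqslant M-1$. *)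

theory Defs
  imports
    "HOL-Algebra.Bij"
    "HOL-Algebra.Generated_Groups"
    "HOL-Library.Extended_Nat"
    "HOL-Library.Stream"
begin

text \<open>
  Substitutions are maps from letters to finite words; only their values on the alphabet \<open>A\<close> matter.
  Columns are restricted to \<open>A\<close> so that they are elements of the permutation group \<^term>\<open>BijGroup A\<close>,
  whose multiplication is composition (right factor applied first).
\<close>

definition constant_length_subst :: "'a set \<Rightarrow> nat \<Rightarrow> ('a \<Rightarrow> 'a list) \<Rightarrow> bool" where
  "constant_length_subst A L \<rho> \<longleftrightarrow> (\<forall>a\<in>A. length (\<rho> a) = L \<and> set (\<rho> a) \<subseteq> A)"

definition column :: "'a set \<Rightarrow> ('a \<Rightarrow> 'a list) \<Rightarrow> nat \<Rightarrow> 'a \<Rightarrow> 'a" where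
  "column A \<rho> i = (\<lambda>a\<in>A. \<rho> a ! i)"

definition palindromic_subst :: "'a set \<Rightarrow> nat \<Rightarrow> ('a \<Rightarrow> 'a list) \<Rightarrow> ('a \<Rightarrow> 'a) \<Rightarrow> bool" where
  "palindromic_subst A L \<rho> h \<longleftrightarrow>
     constant_length_subst A L \<rho> \<and>
     (\<forall>i<L. column A \<rho> i \<in> Bij A) \<and>
     h \<in> generate (BijGroup A) (column A \<rho> ` {..<L}) \<and>
     (\<forall>i<L. column A \<rho> i \<otimes>\<^bsub>BijGroup A\<^esub> column A \<rho> (L - 1 - i) = h)"

text \<open>
  The function \<^const>\<open>flat\<close> concatenates an infinite sequence of words; it is meaningful when
  these are nonempty, as is the case for substitutions of positive constant length.
\<close>

definition subst_stream :: "('a \<Rightarrow> 'a list) \<Rightarrow> 'a stream \<Rightarrow> 'a stream" where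
  "subst_stream \<rho> w = flat (smap \<rho> w)"

definition fixed_point :: "'a set \<Rightarrow> ('a \<Rightarrow> 'a list) \<Rightarrow> 'a stream \<Rightarrow> bool" where
  "fixed_point A \<rho> w \<longleftrightarrow> w \<in> streams A \<and> subst_stream \<rho> w = w"

text \<open>
  Longest monochromatic arithmetic progression of difference \<open>d\<close>. The bound \<open>M = 0\<close> is
  vacuously admissible, which does not affect the supremum.
\<close>

definition max_progression :: "'a stream \<Rightarrow> nat \<Rightarrow> enat" where
  "max_progression w d = Sup {enat M | M. \<exists>k. \<forall>n<M. w !! k = w !! (k + d * n)}"

definition gen_thue_morse :: "nat \<Rightarrow> nat \<Rightarrow> nat list" where
  "gen_thue_morse L a = map (\<lambda>i. (a + i) mod L) [0..<L]"

definition cyclic_shift :: "nat \<Rightarrow> nat \<Rightarrow> nat" where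
  "cyclic_shift L = (\<lambda>a\<in>{..<L}. (a + 1) mod L)"

end

theory Submission
  imports Defs "HOL-Number_Theory.Cong"
begin

text \<open>
  A fixed point satisfies \<open>w\<^bsub>Lk+i\<^esub> = w\<^bsub>k\<^esub> + i\<close> modulo \<open>L\<close>, so \<open>w\<^bsub>m\<^esub>\<close> is \<open>w\<^bsub>0\<^esub>\<close> plus the base-\<open>L\<close> digit
  sum of \<open>m\<close>. With \<open>d = L\<^sup>n - 1\<close> and \<open>j < L\<^sup>n\<close>, the number \<open>d (j + 1) = L\<^sup>n j + (d - j)\<close> consists
  of the digits of \<open>j\<close> followed by their complements, hence has digit sum \<open>n (L - 1)\<close>,
  independently of \<open>j\<close>. The progression therefore starts at \<open>d\<close>.
\<close>

lemma length_gen_thue_morse [simp]: "length (gen_thue_morse L a) = L"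
  by (simp add: gen_thue_morse_def)

lemma nth_gen_thue_morse [simp]: "i < L \<Longrightarrow> gen_thue_morse L a ! i = (a + i) mod L"
  by (simp add: gen_thue_morse_def)

lemma column_gen_thue_morse:
  "i < L \<Longrightarrow> column {..<L} (gen_thue_morse L) i = (\<lambda>a\<in>{..<L}. (a + i) mod L)"
  by (auto simp: column_def fun_eq_iff)

lemma rotation_in_Bij: "(\<lambda>a\<in>{..<L}. (a + i) mod L) \<in> Bij {..<L::nat}"
proof -
  have "inj_on (\<lambda>a\<in>{..<L}. (a + i) mod L) {..<L}"
    by (auto simp: inj_on_def simp flip: cong_def)
       (metis cong_add_rcancel_nat cong_less_modulus_unique_nat)
  moreover have "(\<lambda>a\<in>{..<L}. (a + i) mod L) ` {..<L} \<subseteq> {..<L}"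
    by auto
  ultimately have "bij_betw (\<lambda>a\<in>{..<L}. (a + i) mod L) {..<L} {..<L}"
    by (simp add: bij_betw_def endo_inj_surj)
  then show ?thesis
    by (simp add: Bij_def)
qed

lemma mult_rotation:
  "(\<lambda>a\<in>{..<L}. (a + i) mod L) \<otimes>\<^bsub>BijGroup {..<L}\<^esub> (\<lambda>a\<in>{..<L}. (a + j) mod L)
    = (\<lambda>a\<in>{..<L::nat}. (a + (i + j)) mod L)"
  by (auto simp: rotation_in_Bij BijGroup_def compose_def fun_eq_iff mod_simps ac_simps)

text \<open>Shifts add under composition. This identifies the prescribed power of the cyclic shift
  with a column, reducing palindromicity to arithmetic on shift amounts.\<close>

lemma cyclic_shift_pow:
  "cyclic_shift L [^]\<^bsub>BijGroup {..<L}\<^esub> (m::nat) = (\<lambda>a\<in>{..<L}. (a + m) mod L)"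
proof (induction m)
  case 0
  show ?case
    by (auto simp: nat_pow_def BijGroup_def fun_eq_iff)
next
  case (Suc m)
  then show ?case
    using mult_rotation[of L m 1]
    by (simp add: nat_pow_def cyclic_shift_def del: restrict_apply)
qed

lemma palindromic_gen_thue_morse:
  assumes "L > 0"
  shows "palindromic_subst {..<L} L (gen_thue_morse L)
           (cyclic_shift L [^]\<^bsub>BijGroup {..<L}\<^esub> (L - 1))"
  unfolding palindromic_subst_def
proof (intro conjI allI impI)
  show "constant_length_subst {..<L} L (gen_thue_morse L)"
    using assms by (auto simp: constant_length_subst_def gen_thue_morse_def)
  show "cyclic_shift L [^]\<^bsub>BijGroup {..<L}\<^esub> (L - 1)
      \<in> generate (BijGroup {..<L}) (column {..<L} (gen_thue_morse L) ` {..<L})"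
    \<comment> \<open>The power is itself the last column, hence one of the generators.\<close>
    using assms column_gen_thue_morse[of "L - 1" L]
    by (intro generate.incl image_eqI[of _ _ "L - 1"]) (auto simp: cyclic_shift_pow)
  fix i
  assume i: "i < L"
  then show "column {..<L} (gen_thue_morse L) i \<in> Bij {..<L}"
    by (simp add: column_gen_thue_morse rotation_in_Bij)
  have "i + (L - 1 - i) = L - 1"
    using i by simp
  with i show "column {..<L} (gen_thue_morse L) i
      \<otimes>\<^bsub>BijGroup {..<L}\<^esub> column {..<L} (gen_thue_morse L) (L - 1 - i)
      = cyclic_shift L [^]\<^bsub>BijGroup {..<L}\<^esub> (L - 1)"
    by (simp only: column_gen_thue_morse mult_rotation cyclic_shift_pow)
qed

text \<open>Peeling off the first block shifts the index by exactly \<open>L\<close>. Blocks are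
  nonempty because \<open>i < L\<close>, so \<open>flat\<close> unfolds properly.\<close>

lemma snth_flat_smap:
  assumes len: "\<And>a. length (\<rho> a) = L" and i: "i < L"
  shows "flat (smap \<rho> s) !! (L * k + i) = \<rho> (s !! k) ! i"
proof (induction k arbitrary: s)
  case 0
  have "\<rho> (shd s) \<noteq> []"
    using len[of "shd s"] i by auto
  then show ?case
    using i by (simp add: flat_unfold shift_snth_less len)
next
  case (Suc k)
  have "\<rho> (shd s) \<noteq> []"
    using len[of "shd s"] i by auto
  then have "flat (smap \<rho> s) !! (L * Suc k + i) = flat (smap \<rho> (stl s)) !! (L * k + i)"
    by (simp add: flat_unfold shift_snth_ge len)
  then show ?case
    by (simp add: Suc)
qed

lemma fixed_point_gen_thue_morse_snth:
  assumes "fixed_point A (gen_thue_morse L) w" and "i < L"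
  shows "w !! (L * k + i) = (w !! k + i) mod L"
  using assms snth_flat_smap[of "gen_thue_morse L" L i w k]
  by (simp add: fixed_point_def subst_stream_def)

text \<open>
  The term \<open>f j\<close> is added on the left so that digit complements cancel without subtraction;
  it disappears for \<open>q = j\<close>.
\<close>

lemma complement_cong:
  fixes f :: "nat \<Rightarrow> nat"
  assumes rec: "\<And>k i. i < L \<Longrightarrow> f (L * k + i) = (f k + i) mod L" and "j < L ^ n"
  shows "[f (L ^ n * q + (L ^ n - 1 - j)) + f j = f q + f 0 + n * (L - 1)] (mod L)"
  using \<open>j < L ^ n\<close>
proof (induction n arbitrary: j)
  case 0
  then show ?case by simp
next
  case (Suc n)
  \<comment> \<open>The induction strips the lowest base-\<open>L\<close> digit \<open>i\<close> of
    \<open>j\<close>, leaving \<open>k\<close> with at most \<open>n\<close> digits.\<close>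
  define k i where "k = j div L" and "i = j mod L"
  have L: "L > 0"
    using Suc.prems by (cases L) auto
  have j: "j = L * k + i" and i: "i < L"
    using L by (auto simp: k_def i_def)
  have k: "k < L ^ n"
    using Suc.prems L by (simp add: k_def div_less_iff_less_mult mult.commute)
  \<comment> \<open>Here \<open>c\<close> is the \<open>n\<close>-digit complement of
    \<open>k\<close>, and \<open>e\<close> below is the complement of the digit \<open>i\<close>; as
    witnesses they avoid truncated subtraction.\<close>
  obtain c where c: "L ^ n = Suc (k + c)"
    using k less_imp_Suc_add by blast
  obtain e where e: "L = Suc (i + e)"
    using i less_imp_Suc_add by blast
  have "L ^ Suc n = L * Suc (k + c)"
    by (simp add: c)
  also have "\<dots> = L * k + L * c + L"
    by (simp add: algebra_simps)
  also have "\<dots> = Suc (j + (L * c + e))"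
    using e j by simp
  finally have "L ^ Suc n - 1 - j = L * c + e"
    by simp
  then have "L ^ Suc n * q + (L ^ Suc n - 1 - j) = L * (L ^ n * q + c) + e"
    by (simp add: distrib_left mult.assoc)
  moreover have "[f (L * (L ^ n * q + c) + e) + f (L * k + i)
      = (f (L ^ n * q + c) + e) + (f k + i)] (mod L)"
    using rec[OF i, of k] rec[of e "L ^ n * q + c"] e
    by (intro cong_add) (simp_all add: cong_def)
  moreover have "L ^ n - 1 - k = c" "L - 1 = i + e"
    using c e by simp_all
  ultimately have "[f (L ^ Suc n * q + (L ^ Suc n - 1 - j)) + f j
      = (f (L ^ n * q + (L ^ n - 1 - k)) + f k) + (L - 1)] (mod L)"
    by (simp only: j ac_simps)
  \<comment> \<open>The stripped digit and its complement have contributed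
    \<open>i + e = L - 1\<close>; the rest is the induction hypothesis for \<open>k\<close>.\<close>
  also have "[(f (L ^ n * q + (L ^ n - 1 - k)) + f k) + (L - 1)
      = (f q + f 0 + n * (L - 1)) + (L - 1)] (mod L)"
    by (intro cong_add Suc.IH k cong_refl)
  finally show ?case
    by (simp only: mult_Suc ac_simps)
qed

lemma max_progression_fixed_point_ge:
  assumes fp: "fixed_point {..<L} (gen_thue_morse L) w"
  shows "max_progression w (L ^ n - 1) \<ge> enat (L ^ n)"
proof -
  have less: "w !! k < L" for k
    using fp by (auto simp: fixed_point_def streams_iff_snth)
  have const: "[w !! ((L ^ n - 1) + (L ^ n - 1) * j) = w !! 0 + n * (L - 1)] (mod L)"
    if j: "j < L ^ n" for j
  proof -
    obtain c where c: "L ^ n = Suc (j + c)"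
      using j less_imp_Suc_add by blast
    have "(L ^ n - 1) + (L ^ n - 1) * j = L ^ n * j + (L ^ n - 1 - j)"
      by (simp add: c algebra_simps)
    \<comment> \<open>With \<open>q = j\<close> the letter \<open>w !! j\<close> occurs on both
      sides and cancels.\<close>
    moreover have "[w !! (L ^ n * j + (L ^ n - 1 - j)) + w !! j
        = (w !! 0 + n * (L - 1)) + w !! j] (mod L)"
      using complement_cong[OF fixed_point_gen_thue_morse_snth[OF fp] j, of j]
      by (simp only: ac_simps)
    ultimately show ?thesis
      by (simp only: cong_add_rcancel_nat)
  qed
  have "w !! (L ^ n - 1) = w !! ((L ^ n - 1) + (L ^ n - 1) * j)" if "j < L ^ n" for j
  proof -
    have "[w !! (L ^ n - 1) = w !! 0 + n * (L - 1)] (mod L)"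
      using const[of 0] le_less_trans[OF le0 that] by simp
    then have "[w !! (L ^ n - 1) = w !! ((L ^ n - 1) + (L ^ n - 1) * j)] (mod L)"
      using const[OF that] by (blast intro: cong_trans cong_sym)
    then show ?thesis
      \<comment> \<open>Letters lie below \<open>L\<close>, so congruent letters are equal.\<close>
      by (rule cong_less_modulus_unique_nat[OF _ less less])
  qed
  then show ?thesis
    unfolding max_progression_def by (intro Sup_upper) blast
qed

theorem proposition29:
  fixes L :: nat
  assumes "L \<ge> 2"
  shows "palindromic_subst {..<L} L (gen_thue_morse L)
           (cyclic_shift L [^]\<^bsub>BijGroup {..<L}\<^esub> (L - 1)) \<and>
         (\<forall>w. fixed_point {..<L} (gen_thue_morse L) w \<longrightarrow>
           (\<forall>n\<ge>1. max_progression w (L ^ n - 1) \<ge> enat (L ^ n)))"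
  using assms palindromic_gen_thue_morse[of L] max_progression_fixed_point_ge by simp

end
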